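(* The ideal $I(\mathbb{A}^r_G(\mathbb{F}_q))\subseteq S$ is binomial, i.e. it is generated by binomials (polynomials with at most two terms).
   Context: Let $\beta=[\beta_1\cdots\beta_r]$ be a $d\times r$ matrix of rank $d$ with non-negative integer entries, $n=r-d>0$. Let $\mathbb{F}_q$ be a finite field, $\mathbb{K}=\overline{\mathbb{F}}_q$ an algebraic closure, and $S=\mathbb{F}_q[x_1,\dots,x_r]$, $\mathbb{Z}^d$-graded by $\deg_\beta(x_j)=\beta_j$ (the graded pieces $S_\alpha$ are finite-dimensional); "homogeneous" refers to this grading. It is assumed that there is a short exact sequence $0\to\mathbb{Z}^n\xrightarrow{\phi}\mathbb{Z}^r\xrightarrow{\beta}\mathbb{Z}^d\to 0$; let $\mathbf{u}_1,\dots,\mathbf{u}_n$ be the columns of $\phi$. The group $G=\{\mathbf{t}\in(\mathbb{K}^* )^r:\mathbf{t}^{\mathbf{u}_1}=\cdots=\mathbf{t}^{\mathbf{u}_n}=1\}$ acts on $\mathbb{K}^r$ by coordinatewise multiplication, and $\mathbb{A}^r_G(\mathbb{F}_q)=\mathbb{F}_q^r/G$ is the set of $G$-orbits $[P]=G\cdot P$ of points $P\in\mathbb{F}_q^r$. For a set $Y_G$ of such orbits, $I(Y_G)\subseteq S$ is the ideal generated by the homogeneous polynomials in $S$ vanishing at all $P$ with $[P]\in Y_G$ (for homogeneous $F$, vanishing at $P$ depends only on $[P]$). *)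

theory Defs
  imports
    "HOL-Analysis.Analysis"
    "HOL-Library.Poly_Mapping"
    "HOL-Algebra.Algebraic_Closure_Type"
begin

text \<open>
  Polynomials in variables indexed by \<open>'r\<close> over \<open>'a\<close>: finitely supported maps from exponent
  vectors to coefficients, with the convolution product of \<open>Poly_Mapping\<close>.
\<close>

type_synonym ('r, 'a) mvpoly = "('r \<Rightarrow>\<^sub>0 nat) \<Rightarrow>\<^sub>0 'a"

definition poly_scale :: "'a::field \<Rightarrow> ('r, 'a) mvpoly \<Rightarrow> ('r, 'a) mvpoly" where
  "poly_scale c p = Poly_Mapping.single 0 c * p"

definition poly_at :: "('r::finite, 'a::field) mvpoly \<Rightarrow> 'a ^ 'r \<Rightarrow> 'a" where
  "poly_at p P =
     (\<Sum>m \<in> Poly_Mapping.keys p.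
        Poly_Mapping.lookup p m * (\<Prod>j\<in>UNIV. (P $ j) ^ Poly_Mapping.lookup m j))"

text \<open>
  The degree \<open>\<Sum>j. a j \<cdot> \<beta>\<^sub>j\<close> of the monomial with exponents \<open>a\<close>, where \<open>\<beta>\<^sub>j\<close> is
  the \<open>j\<close>-th column of \<open>\<beta>\<close>.
\<close>

definition monom_deg :: "int ^ 'r::finite ^ 'd \<Rightarrow> ('r \<Rightarrow>\<^sub>0 nat) \<Rightarrow> int ^ 'd" where
  "monom_deg \<beta> m = \<beta> *v (\<chi> j. int (Poly_Mapping.lookup m j))"

definition graded_piece ::
    "int ^ 'r::finite ^ 'd \<Rightarrow> int ^ 'd \<Rightarrow> ('r, 'a::field) mvpoly set" where
  "graded_piece \<beta> \<alpha> = {p. \<forall>m \<in> Poly_Mapping.keys p. monom_deg \<beta> m = \<alpha>}"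

definition homogeneous :: "int ^ 'r::finite ^ 'd \<Rightarrow> ('r, 'a::field) mvpoly \<Rightarrow> bool" where
  "homogeneous \<beta> p \<longleftrightarrow> (\<exists>\<alpha>. p \<in> graded_piece \<beta> \<alpha>)"

definition fin_dim :: "('r, 'a::field) mvpoly set \<Rightarrow> bool" where
  "fin_dim V \<longleftrightarrow> (\<exists>B. finite B \<and> V = module.span poly_scale B)"

text \<open>Exactness of \<open>0 \<longrightarrow> \<int>\<^sup>n \<longrightarrow> \<int>\<^sup>r \<longrightarrow> \<int>\<^sup>d \<longrightarrow> 0\<close>, the maps being the matrices \<open>\<phi>\<close> and \<open>\<beta>\<close>.\<close>

definition short_exact :: "int ^ 'n::finite ^ 'r::finite \<Rightarrow> int ^ 'r ^ 'd::finite \<Rightarrow> bool" where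
  "short_exact \<phi> \<beta> \<longleftrightarrow>
     inj ((*v) \<phi>) \<and> range ((*v) \<phi>) = {v. \<beta> *v v = 0} \<and> surj ((*v) \<beta>)"

text \<open>The algebraic closure of \<open>'a\<close> is the type \<open>'a alg_closure\<close>, with embedding \<open>to_ac\<close>.\<close>

definition torus_subgroup :: "int ^ 'n ^ 'r::finite \<Rightarrow> ('a::field alg_closure ^ 'r) set" where
  "torus_subgroup \<phi> =
     {t. (\<forall>j. t $ j \<noteq> 0) \<and> (\<forall>i. (\<Prod>j\<in>UNIV. (t $ j) powi (column i \<phi> $ j)) = 1)}"

definition G_orbit ::
    "int ^ 'n ^ 'r::finite \<Rightarrow> 'a::field ^ 'r \<Rightarrow> ('a alg_closure ^ 'r) set" where
  "G_orbit \<phi> P = {(\<chi> j. t $ j * to_ac (P $ j)) | t. t \<in> torus_subgroup \<phi>}"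

definition affine_orbits :: "int ^ 'n ^ 'r::finite \<Rightarrow> ('a::field alg_closure ^ 'r) set set" where
  "affine_orbits \<phi> = range (G_orbit \<phi> :: 'a ^ 'r \<Rightarrow> ('a alg_closure ^ 'r) set)"

text \<open>The ideal generated by \<open>A\<close>: the span of \<open>A\<close> in the ring regarded as a module over itself.\<close>

definition ideal_gen :: "'p::comm_ring_1 set \<Rightarrow> 'p set" where
  "ideal_gen A = module.span (*) A"

definition vanishing_ideal ::
    "int ^ 'n ^ 'r::finite \<Rightarrow> int ^ 'r ^ 'd \<Rightarrow> ('a::field alg_closure ^ 'r) set set
      \<Rightarrow> ('r, 'a) mvpoly set" where
  "vanishing_ideal \<phi> \<beta> Y =
     ideal_gen {F. homogeneous \<beta> F \<and> (\<forall>P. G_orbit \<phi> P \<in> Y \<longrightarrow> poly_at F P = 0)}"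

definition is_binomial :: "('r, 'a::field) mvpoly \<Rightarrow> bool" where
  "is_binomial p \<longleftrightarrow> card (Poly_Mapping.keys p) \<le> 2"

definition binomial_ideal :: "('r, 'a::field) mvpoly set \<Rightarrow> bool" where
  "binomial_ideal I \<longleftrightarrow> (\<exists>B. (\<forall>b\<in>B. is_binomial b) \<and> I = ideal_gen B)"

end

theory Submission
  imports Defs
begin

text \<open>
  Monomials act on points as multiplicative functions, and distinct multiplicative functions into a
  field are linearly independent (Dedekind). Hence in a polynomial that vanishes at every point, the
  coefficients of the monomials inducing any given function add up to \<open>0\<close>, so every monomial \<open>x\<^sup>m\<close>
  with coefficient \<open>c \<noteq> 0\<close> has a partner \<open>x\<^sup>m\<^sup>'\<close> inducing the same function. If the polynomial is
  homogeneous, subtracting the homogeneous vanishing binomial \<open>c x\<^sup>m - c x\<^sup>m\<^sup>'\<close> removes \<open>x\<^sup>m\<close> and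
  introduces no new monomial; iterating, the polynomial is a sum of such binomials.
\<close>

text \<open>Dedekind's argument, by induction on the size of \<open>M\<close>: the relation at
  \<open>mul x y\<close> minus \<open>g y\<close> times the relation at \<open>x\<close> is a
  relation without \<open>g\<close>. The point \<open>e\<close> serves to exclude the zero
  function.\<close>

lemma multiplicative_functions_independent:
  fixes M :: "('m \<Rightarrow> 'a::field) set" and mul :: "'m \<Rightarrow> 'm \<Rightarrow> 'm"
  assumes "finite M"
    and "\<And>f x y. f \<in> M \<Longrightarrow> f (mul x y) = f x * f y"
    and "\<And>f. f \<in> M \<Longrightarrow> f e \<noteq> 0"
    and "\<And>x. (\<Sum>f\<in>M. c f * f x) = 0"
    and "f \<in> M"
  shows "c f = 0"
  using assms
proof (induction M arbitrary: c f rule: finite_induct)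
  case empty
  then show ?case by simp
next
  case (insert g M)
  note mult = insert.prems(1) and nz = insert.prems(2) and zero = insert.prems(3)
  have c0: "c h = 0" if h: "h \<in> M" for h
  proof -
    have "h \<noteq> g" using h insert.hyps by blast
    then obtain y where y: "h y \<noteq> g y" by blast
    have "(\<Sum>f\<in>M. (c f * (f y - g y)) * f x) = 0" for x
    proof -
      \<comment> \<open>The sum may be extended to \<open>g\<close>, whose new coefficient
        \<open>c g * (g y - g y)\<close> is 0.\<close>
      have "(\<Sum>f\<in>M. (c f * (f y - g y)) * f x)
          = (\<Sum>f\<in>insert g M. (c f * (f y - g y)) * f x)"
        using insert.hyps by simp
      also have "\<dots> = (\<Sum>f\<in>insert g M. c f * f (mul x y)) - g y * (\<Sum>f\<in>insert g M. c f * f x)"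
        unfolding sum_distrib_left sum_subtractf[symmetric]
        by (rule sum.cong) (simp_all add: mult algebra_simps)
      finally show ?thesis using zero by simp
    qed
    then have "c h * (h y - g y) = 0"
      using insert.IH[of "\<lambda>f. c f * (f y - g y)" h] mult nz h by simp
    with y show ?thesis by simp
  qed
  \<comment> \<open>With all other coefficients known to be 0, the relation at \<open>e\<close>
    reduces to its \<open>g\<close>-term.\<close>
  have "c g * g e = 0"
    using zero[of e] insert.hyps c0 by simp
  then have "c g = 0" using nz by simp
  with c0 insert.prems(4) show ?case by blast
qed

definition monom_at :: "('r::finite \<Rightarrow>\<^sub>0 nat) \<Rightarrow> 'a::field ^ 'r \<Rightarrow> 'a" where
  "monom_at m P = (\<Prod>j\<in>UNIV. (P $ j) ^ Poly_Mapping.lookup m j)"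

lemma monom_at_mult: "monom_at m (\<chi> j. P $ j * Q $ j) = monom_at m P * monom_at m Q"
  by (simp add: monom_at_def power_mult_distrib prod.distrib)

lemma monom_at_ones: "monom_at m (\<chi> j. 1) = 1"
  by (simp add: monom_at_def)

lemma poly_at_superset:
  assumes "finite A" "Poly_Mapping.keys p \<subseteq> A"
  shows "poly_at p P = (\<Sum>m\<in>A. Poly_Mapping.lookup p m * monom_at m P)"
  unfolding poly_at_def monom_at_def
  using assms by (intro sum.mono_neutral_left) (auto simp: in_keys_iff)

lemma poly_at_diff: "poly_at (p - q) P = poly_at p P - poly_at q P"
proof -
  let ?A = "Poly_Mapping.keys p \<union> Poly_Mapping.keys q"
  have "Poly_Mapping.keys (p - q) \<subseteq> ?A" by (rule keys_diff)
  then show ?thesis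
    by (simp add: poly_at_superset[of ?A] lookup_minus left_diff_distrib sum_subtractf)
qed

lemma poly_at_single: "poly_at (Poly_Mapping.single m c) P = c * monom_at m P"
  by (subst poly_at_superset[of "{m}"]) auto

text \<open>Terms are grouped by the function that their monomial induces. By independence each
  group has coefficient sum 0, whereas a group consisting of \<open>m\<close> alone would have the
  nonzero coefficient of \<open>m\<close> as its sum.\<close>

lemma vanishing_poly_partner:
  fixes F :: "('r::finite, 'a::field) mvpoly"
  assumes van: "\<And>P. poly_at F P = 0" and m: "m \<in> Poly_Mapping.keys F"
  obtains m' where "m' \<in> Poly_Mapping.keys F" "m' \<noteq> m"
    "monom_at m' = (monom_at m :: 'a ^ 'r \<Rightarrow> 'a)"
proof -
  let ?K = "Poly_Mapping.keys F"
  let ?mon = "monom_at :: _ \<Rightarrow> 'a ^ 'r \<Rightarrow> 'a"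
  let ?c = "\<lambda>f. \<Sum>k\<in>{k\<in>?K. ?mon k = f}. Poly_Mapping.lookup F k"
  have "(\<Sum>f\<in>?mon ` ?K. ?c f * f P) = 0" for P
  proof -
    have "(\<Sum>f\<in>?mon ` ?K. ?c f * f P)
        = (\<Sum>f\<in>?mon ` ?K. \<Sum>k\<in>{k\<in>?K. ?mon k = f}. Poly_Mapping.lookup F k * ?mon k P)"
      by (simp add: sum_distrib_right)
    also have "\<dots> = (\<Sum>k\<in>?K. Poly_Mapping.lookup F k * ?mon k P)"
      by (rule sum.image_gen[symmetric]) simp
    also have "\<dots> = 0" using van[of P] by (simp add: poly_at_superset[of ?K])
    finally show ?thesis .
  qed
  \<comment> \<open>Points are multiplied coordinatewise; at the all-ones point every monomial takes
    the value 1.\<close>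
  then have "?c (?mon m) = 0"
  proof (rule multiplicative_functions_independent
      [where M = "?mon ` ?K" and c = ?c and f = "?mon m"
        and mul = "\<lambda>P Q. \<chi> j. P $ j * Q $ j" and e = "\<chi> j. 1", rotated 3])
    show "?mon m \<in> ?mon ` ?K" using m by (rule imageI)
  qed (auto simp only: finite_imageI finite_keys image_iff monom_at_mult monom_at_ones one_neq_zero)
  moreover have "{k\<in>?K. ?mon k = ?mon m} \<noteq> {m}"
  proof
    assume "{k\<in>?K. ?mon k = ?mon m} = {m}"
    with \<open>?c (?mon m) = 0\<close> have "Poly_Mapping.lookup F m = 0" by simp
    with m show False by (simp add: in_keys_iff)
  qed
  ultimately show ?thesis using m that by blast
qed

text \<open>Makes the general facts about spans available for \<open>ideal_gen\<close>.\<close>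

lemma module_mult: "Modules.module ((*) :: 'p::comm_ring_1 \<Rightarrow> 'p \<Rightarrow> 'p)"
  by unfold_locales (simp_all add: algebra_simps)

text \<open>The binomials are kept homogeneous and vanishing, so that they lie in the vanishing
  ideal themselves and generate no more than it.\<close>

lemma vanishing_homogeneous_in_binomial_ideal:
  fixes F :: "('r::finite, 'a::field) mvpoly"
  assumes "homogeneous \<beta> F" "\<And>P. poly_at F P = 0"
  shows "F \<in> ideal_gen {b. homogeneous \<beta> b \<and> (\<forall>P. poly_at b P = 0) \<and> is_binomial b}"
    (is "_ \<in> ideal_gen ?B")
  using assms
proof (induction "card (Poly_Mapping.keys F)" arbitrary: F rule: less_induct)
  case less
  interpret M: Modules.module "(*) :: ('r, 'a) mvpoly \<Rightarrow> _" by (rule module_mult)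
  show ?case
  proof (cases "F = 0")
    case True
    then show ?thesis by (simp add: ideal_gen_def M.span_zero)
  next
    case False
    then obtain m where m: "m \<in> Poly_Mapping.keys F" by (metis keys_eq_empty ex_in_conv)
    obtain m' where m': "m' \<in> Poly_Mapping.keys F" "m' \<noteq> m"
      and eq: "monom_at m' = (monom_at m :: 'a ^ 'r \<Rightarrow> 'a)"
      using vanishing_poly_partner[OF less.prems(2) m] by blast
    define c where "c = Poly_Mapping.lookup F m"
    \<comment> \<open>The choice of \<open>c\<close> cancels the term of \<open>F\<close> at
      \<open>m\<close>; the only other coefficient affected is the one at \<open>m'\<close>, which
      is already in the support. So \<open>F - b\<close> has fewer terms.\<close>
    define b where "b = Poly_Mapping.single m c - Poly_Mapping.single m' c"
    have keys_b: "Poly_Mapping.keys b \<subseteq> {m, m'}"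
      unfolding b_def using keys_diff[of "Poly_Mapping.single m c" "Poly_Mapping.single m' c"]
      by (auto split: if_splits)
    have van_b: "poly_at b P = 0" for P
      by (simp add: b_def poly_at_diff poly_at_single eq)
    obtain \<alpha> where \<alpha>: "F \<in> graded_piece \<beta> \<alpha>"
      using less.prems(1) by (auto simp: homogeneous_def)
    \<comment> \<open>Both exponents occur in \<open>F\<close>, hence both have degree
      \<alpha>.\<close>
    have "b \<in> graded_piece \<beta> \<alpha>"
      using \<alpha> keys_b m m' by (auto simp: graded_piece_def)
    then have "homogeneous \<beta> b" by (auto simp: homogeneous_def)
    moreover have "is_binomial b"
      unfolding is_binomial_def using card_mono[OF _ keys_b] m'(2) by simp
    ultimately have b: "b \<in> ?B" using van_b by simp
    have keys_sub: "Poly_Mapping.keys (F - b) \<subseteq> Poly_Mapping.keys F"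
      using keys_diff[of F b] keys_b m m' by blast
    have "m \<notin> Poly_Mapping.keys (F - b)"
      using m'(2) by (simp add: in_keys_iff lookup_minus b_def c_def lookup_single)
    with keys_sub m have "card (Poly_Mapping.keys (F - b)) < card (Poly_Mapping.keys F)"
      by (intro psubset_card_mono) auto
    moreover have "homogeneous \<beta> (F - b)"
      using \<alpha> keys_sub by (auto simp: homogeneous_def graded_piece_def)
    moreover have "poly_at (F - b) P = 0" for P
      using less.prems(2) van_b by (simp add: poly_at_diff)
    ultimately have "F - b \<in> ideal_gen ?B" by (rule less.hyps)
    with b have "(F - b) + b \<in> ideal_gen ?B"
      unfolding ideal_gen_def by (rule M.span_add[OF _ M.span_base, rotated])
    then show ?thesis by simp
  qed
qed

theorem corollary2p4:
  fixes \<beta> :: "int ^ 'r::finite ^ 'd::finite"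
    and \<phi> :: "int ^ 'n::finite ^ 'r"
  assumes "\<And>i j. 0 \<le> \<beta> $ i $ j"
    and "rank (map_matrix real_of_int \<beta>) = CARD('d)"
    and "CARD('r) = CARD('d) + CARD('n)"
    and "short_exact \<phi> \<beta>"
    and "\<And>\<alpha>. fin_dim (graded_piece \<beta> \<alpha> :: ('r, 'a::{field, finite}) mvpoly set)"
  shows "binomial_ideal
    (vanishing_ideal \<phi> \<beta> (affine_orbits \<phi> :: ('a alg_closure ^ 'r) set set))"
proof -
  interpret M: Modules.module "(*) :: ('r, 'a) mvpoly \<Rightarrow> _" by (rule module_mult)
  let ?H = "{F :: ('r, 'a) mvpoly. homogeneous \<beta> F \<and> (\<forall>P. poly_at F P = 0)}"
  let ?B = "{b :: ('r, 'a) mvpoly. homogeneous \<beta> b \<and> (\<forall>P. poly_at b P = 0) \<and> is_binomial b}"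
  have "?H \<subseteq> ideal_gen ?B"
    using vanishing_homogeneous_in_binomial_ideal by blast
  moreover have "?B \<subseteq> ideal_gen ?H"
    unfolding ideal_gen_def by (auto intro: M.span_base)
  \<comment> \<open>Two sets span the same ideal once each lies in the span of the other.\<close>
  ultimately have "ideal_gen ?H = ideal_gen ?B"
    unfolding ideal_gen_def by (rule M.span_eq[THEN iffD2, OF conjI])
  \<comment> \<open>Every orbit of a point over the base field belongs to
    \<open>affine_orbits \<phi>\<close>, so the condition on orbits becomes vanishing at all
    points.\<close>
  moreover have "vanishing_ideal \<phi> \<beta> (affine_orbits \<phi> :: ('a alg_closure ^ 'r) set set) = ideal_gen ?H"
    by (simp add: vanishing_ideal_def affine_orbits_def)
  ultimately show ?thesis
    unfolding binomial_ideal_def by (intro exI[of _ ?B]) simp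
qed

end
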